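(* Let $\mathbb{X}=\langle X,\{\rho_i:i\in I\}\rangle$ be a relational structure and let $\mathbb{P}(\mathbb{X})=\{A\subseteq X:\langle A,\{\rho_i\cap A^{n_i}:i\in I\}\rangle\cong\mathbb{X}\}$, where $n_i$ is the arity of $\rho_i$. Then: (a) $\langle \mathbb{P}(\mathbb{X}),\subseteq\rangle$ is a homogeneous poset; (b) $\langle \mathbb{P}(\mathbb{X}),\subseteq\rangle$ is either atomless or atomic; (c) $\langle \mathbb{P}(\mathbb{X}),\subseteq\rangle$ is atomless if and only if it contains two incompatible elements; (d) if $\langle \mathbb{P}(\mathbb{X}),\subseteq\rangle$ is atomic, then $\mathrm{At}(\mathbb{P}(\mathbb{X}))=\mathbb{P}(\mathbb{X})$ and $\mathbb{P}(\mathbb{X})$ is a uniform filter base on $X$; moreover $\bigcap\mathbb{P}(\mathbb{X})\in\mathbb{P}(\mathbb{X})$ if and only if $\mathbb{P}(\mathbb{X})=\{X\}$.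
   Context: Equivalently $\mathbb{P}(\mathbb{X})=\{f[X]: f \text{ an embedding of }\mathbb{X}\text{ into itself}\}$. For a poset $\mathbb{P}=\langle P,\le\rangle$: $p,q$ are compatible iff there is $r\le p,q$, otherwise incompatible; $p$ is an atom ($p\in\mathrm{At}(\mathbb{P})$) iff any two $q,r\le p$ are compatible; $\mathbb{P}$ is atomless iff $\mathrm{At}(\mathbb{P})=\emptyset$, atomic iff $\mathrm{At}(\mathbb{P})$ is dense in $\mathbb{P}$; $\mathbb{P}$ is homogeneous iff it has a largest element and $\mathbb{P}\cong(-\infty,p]_{\mathbb{P}}$ for every $p\in P$. A family $\mathcal{B}$ is a uniform filter base on $X$ iff $\emptyset\neq\mathcal{B}\subseteq[X]^{|X|}$ and for all $A,B\in\mathcal{B}$ there is $C\in\mathcal{B}$ with $C\subseteq A\cap B$. *)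

theory Defs
  imports Main "HOL-Library.NList" "HOL-Library.Equipollence"
begin

section \<open>Relational structures\<close>

text \<open>
  An \<^emph>\<open>n\<close>-tuple over \<^emph>\<open>X\<close> is a list in \<^term>\<open>nlists n X\<close>. A relational structure is given by its
  domain \<^emph>\<open>X\<close>, an index set \<^emph>\<open>I\<close>, the arities \<^emph>\<open>ar\<close> and the relations \<^emph>\<open>\<rho>\<close>; the values of \<^emph>\<open>ar\<close> and
  \<^emph>\<open>\<rho>\<close> outside \<^emph>\<open>I\<close> are irrelevant. The domain, the index set and the arities may be empty or 0.
\<close>

definition relational_structure ::
    "'i set \<Rightarrow> ('i \<Rightarrow> nat) \<Rightarrow> 'a set \<Rightarrow> ('i \<Rightarrow> 'a list set) \<Rightarrow> bool" where
  "relational_structure I ar X \<rho> \<longleftrightarrow> (\<forall>i\<in>I. \<rho> i \<subseteq> nlists (ar i) X)"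

definition rel_isomorphism ::
    "'i set \<Rightarrow> ('i \<Rightarrow> nat) \<Rightarrow> 'a set \<Rightarrow> ('i \<Rightarrow> 'a list set) \<Rightarrow> 'b set \<Rightarrow> ('i \<Rightarrow> 'b list set) \<Rightarrow>
      ('a \<Rightarrow> 'b) \<Rightarrow> bool" where
  "rel_isomorphism I ar X \<rho> Y \<sigma> f \<longleftrightarrow>
     bij_betw f X Y \<and> (\<forall>i\<in>I. \<forall>xs\<in>nlists (ar i) X. xs \<in> \<rho> i \<longleftrightarrow> map f xs \<in> \<sigma> i)"

definition rel_isomorphic ::
    "'i set \<Rightarrow> ('i \<Rightarrow> nat) \<Rightarrow> 'a set \<Rightarrow> ('i \<Rightarrow> 'a list set) \<Rightarrow> 'b set \<Rightarrow> ('i \<Rightarrow> 'b list set) \<Rightarrow> bool" where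
  "rel_isomorphic I ar X \<rho> Y \<sigma> \<longleftrightarrow> (\<exists>f. rel_isomorphism I ar X \<rho> Y \<sigma> f)"

definition self_copies ::
    "'i set \<Rightarrow> ('i \<Rightarrow> nat) \<Rightarrow> 'a set \<Rightarrow> ('i \<Rightarrow> 'a list set) \<Rightarrow> 'a set set" where
  "self_copies I ar X \<rho> =
     {A. A \<subseteq> X \<and> rel_isomorphic I ar A (\<lambda>i. \<rho> i \<inter> nlists (ar i) A) X \<rho>}"


section \<open>Posets\<close>

text \<open>
  A poset is a carrier \<^emph>\<open>P\<close> with a relation \<^emph>\<open>r\<close> such that \<^term>\<open>partial_order_on P r\<close>;
  here \<^term>\<open>(p, q) \<in> r\<close> means that \<^emph>\<open>p\<close> is below \<^emph>\<open>q\<close>.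
\<close>

definition inclusion :: "'a set set \<Rightarrow> 'a set rel" where
  "inclusion P = relation_of (\<subseteq>) P"

definition compatible :: "'p set \<Rightarrow> 'p rel \<Rightarrow> 'p \<Rightarrow> 'p \<Rightarrow> bool" where
  "compatible P r p q \<longleftrightarrow> (\<exists>s\<in>P. (s, p) \<in> r \<and> (s, q) \<in> r)"

text \<open>These are the forcing-theoretic atoms, which need not be minimal elements.\<close>

definition At :: "'p set \<Rightarrow> 'p rel \<Rightarrow> 'p set" where
  "At P r = {p \<in> P. \<forall>q\<in>P. \<forall>s\<in>P. (q, p) \<in> r \<longrightarrow> (s, p) \<in> r \<longrightarrow> compatible P r q s}"

definition atomless :: "'p set \<Rightarrow> 'p rel \<Rightarrow> bool" where
  "atomless P r \<longleftrightarrow> At P r = {}"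

definition dense_in :: "'p set \<Rightarrow> 'p rel \<Rightarrow> 'p set \<Rightarrow> bool" where
  "dense_in P r D \<longleftrightarrow> D \<subseteq> P \<and> (\<forall>p\<in>P. \<exists>d\<in>D. (d, p) \<in> r)"

definition atomic :: "'p set \<Rightarrow> 'p rel \<Rightarrow> bool" where
  "atomic P r \<longleftrightarrow> dense_in P r (At P r)"

definition poset_isomorphic :: "'p set \<Rightarrow> 'p rel \<Rightarrow> 'q set \<Rightarrow> 'q rel \<Rightarrow> bool" where
  "poset_isomorphic P r Q s \<longleftrightarrow>
     (\<exists>f. bij_betw f P Q \<and> (\<forall>p\<in>P. \<forall>q\<in>P. (p, q) \<in> r \<longleftrightarrow> (f p, f q) \<in> s))"

definition principal_ideal :: "'p set \<Rightarrow> 'p rel \<Rightarrow> 'p \<Rightarrow> 'p set" where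
  "principal_ideal P r p = {q \<in> P. (q, p) \<in> r}"

definition homogeneous_poset :: "'p set \<Rightarrow> 'p rel \<Rightarrow> bool" where
  "homogeneous_poset P r \<longleftrightarrow>
     partial_order_on P r \<and>
     (\<exists>m\<in>P. \<forall>p\<in>P. (p, m) \<in> r) \<and>
     (\<forall>p\<in>P. poset_isomorphic P r (principal_ideal P r p)
        (r \<inter> principal_ideal P r p \<times> principal_ideal P r p))"


section \<open>Uniform filter bases\<close>

definition uniform_filter_base :: "'a set \<Rightarrow> 'a set set \<Rightarrow> bool" where
  "uniform_filter_base X B \<longleftrightarrow>
     B \<noteq> {} \<and> B \<subseteq> {A. A \<subseteq> X \<and> A \<approx> X} \<and> (\<forall>A\<in>B. \<forall>A'\<in>B. \<exists>C\<in>B. C \<subseteq> A \<inter> A')"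

end

theory Submission
  imports Defs
begin

text \<open>
  If \<^emph>\<open>f\<close> is a self-embedding with image \<^emph>\<open>A\<close>, then a subset \<^emph>\<open>B\<close> of \<^emph>\<open>X\<close> is a copy of the structure
  iff \<^emph>\<open>f[B]\<close> is one; so \<^emph>\<open>B \<mapsto> f[B]\<close> identifies the poset of copies with its principal ideal below
  \<^emph>\<open>A\<close>. Hence one pair of incompatible copies yields such a pair below every copy, and a least copy
  forces all copies to coincide with \<^emph>\<open>X\<close>.
\<close>

section \<open>Order theory of a family of sets that is replicated below each of its members\<close>

locale self_similar_family =
  fixes X :: "'a set" and P :: "'a set set"
  assumes top: "X \<in> P"
    and self_similar: "A \<in> P \<Longrightarrow>
      \<exists>f. inj_on f X \<and> f ` X = A \<and> A \<subseteq> X \<and> (\<forall>B\<subseteq>X. f ` B \<in> P \<longleftrightarrow> B \<in> P)"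
begin

lemma subset_top: "A \<in> P \<Longrightarrow> A \<subseteq> X"
  using self_similar by blast

text \<open>Both directions of the equivalence in \<open>self_similar\<close> matter: images of
  members are members, so \<open>image f\<close> stays inside \<open>P\<close>; and a member below
  \<open>A\<close> is the image of a subset of \<open>X\<close> that must itself be a member, so the
  map is onto the ideal. Injectivity of \<open>f\<close> lets it reflect inclusion.\<close>

lemma replicaE:
  assumes "A \<in> P"
  obtains f where "inj_on f X" "f ` X = A" "bij_betw (image f) P {B \<in> P. B \<subseteq> A}"
    "\<And>B C. B \<in> P \<Longrightarrow> C \<in> P \<Longrightarrow> f ` B \<subseteq> f ` C \<longleftrightarrow> B \<subseteq> C"
proof -
  obtain f where f: "inj_on f X" "f ` X = A" and mem: "\<And>B. B \<subseteq> X \<Longrightarrow> f ` B \<in> P \<longleftrightarrow> B \<in> P"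
    using self_similar[OF assms] by blast
  have mono: "f ` B \<subseteq> f ` C \<longleftrightarrow> B \<subseteq> C" if "B \<in> P" "C \<in> P" for B C
  proof -
    have "f x \<in> f ` C \<longleftrightarrow> x \<in> C" if "x \<in> B" for x
      using inj_on_image_mem_iff[OF f(1), of x C] subset_top \<open>B \<in> P\<close> \<open>C \<in> P\<close> that by blast
    then show ?thesis
      by blast
  qed
  have "inj_on (image f) P"
    by (rule inj_onI) (metis mono order_refl subset_antisym)
  moreover have "image f ` P = {B \<in> P. B \<subseteq> A}"
  proof
    show "image f ` P \<subseteq> {B \<in> P. B \<subseteq> A}"
      using mem subset_top f(2) by blast
    show "{B \<in> P. B \<subseteq> A} \<subseteq> image f ` P"
    proof
      fix B assume B: "B \<in> {B \<in> P. B \<subseteq> A}"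
      then obtain C where "C \<subseteq> X" "B = f ` C"
        using f(2) by (metis mem_Collect_eq subset_imageE)
      then show "B \<in> image f ` P"
        using B mem by blast
    qed
  qed
  ultimately show thesis
    using that f mono by (simp add: bij_betw_def)
qed

text \<open>The memberships of \<open>A\<close> and \<open>B\<close> appear because
  \<open>inclusion P\<close> relates only members of \<open>P\<close>.\<close>

lemma compatible_iff:
  "compatible P (inclusion P) A B \<longleftrightarrow> A \<in> P \<and> B \<in> P \<and> (\<exists>C\<in>P. C \<subseteq> A \<inter> B)"
  by (auto simp: compatible_def inclusion_def relation_of_def)

lemma homogeneous: "homogeneous_poset P (inclusion P)"
proof -
  have "partial_order_on P (inclusion P)"
    unfolding inclusion_def by (rule partial_order_on_relation_ofI) auto
  moreover have "\<exists>M\<in>P. \<forall>A\<in>P. (A, M) \<in> inclusion P"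
    using top subset_top by (auto simp: inclusion_def relation_of_def)
  moreover have "poset_isomorphic P (inclusion P) (principal_ideal P (inclusion P) A)
      (inclusion P \<inter> principal_ideal P (inclusion P) A \<times> principal_ideal P (inclusion P) A)"
    if A: "A \<in> P" for A
  proof -
    obtain f where f: "bij_betw (image f) P {B \<in> P. B \<subseteq> A}"
        "\<And>B C. B \<in> P \<Longrightarrow> C \<in> P \<Longrightarrow> f ` B \<subseteq> f ` C \<longleftrightarrow> B \<subseteq> C"
      using replicaE[OF A] by metis
    have ideal: "principal_ideal P (inclusion P) A = {B \<in> P. B \<subseteq> A}"
      using A by (auto simp: principal_ideal_def inclusion_def relation_of_def)
    have "f ` B \<in> P \<and> f ` B \<subseteq> A" if "B \<in> P" for B
      using bij_betwE[OF f(1)] that by simp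
    then show ?thesis
      unfolding poset_isomorphic_def ideal using f
      by (intro exI[of _ "image f"]) (simp add: inclusion_def relation_of_def)
  qed
  ultimately show ?thesis
    by (simp add: homogeneous_poset_def)
qed

lemma incompatible_below:
  assumes "B \<in> P" "C \<in> P" "\<not> compatible P (inclusion P) B C" and A: "A \<in> P"
  shows "\<exists>B'\<in>P. \<exists>C'\<in>P. B' \<subseteq> A \<and> C' \<subseteq> A \<and> \<not> compatible P (inclusion P) B' C'"
proof -
  obtain f where f: "bij_betw (image f) P {B \<in> P. B \<subseteq> A}"
      "\<And>B C. B \<in> P \<Longrightarrow> C \<in> P \<Longrightarrow> f ` B \<subseteq> f ` C \<longleftrightarrow> B \<subseteq> C"
    using replicaE[OF A] by metis
  have im: "f ` D \<in> P \<and> f ` D \<subseteq> A" if "D \<in> P" for D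
    using bij_betwE[OF f(1)] that by simp
  have "\<not> compatible P (inclusion P) (f ` B) (f ` C)"
  proof
    assume "compatible P (inclusion P) (f ` B) (f ` C)"
    then obtain D where D: "D \<in> P" "D \<subseteq> f ` B" "D \<subseteq> f ` C"
      by (auto simp: compatible_iff)
    \<comment> \<open>A common lower bound of the two images lies below \<open>A\<close>, hence in
      the range of \<open>image f\<close>; its preimage is then a common lower bound of
      \<open>B\<close> and \<open>C\<close>.\<close>
    then have "D \<in> image f ` P"
      using im[OF assms(1)] bij_betw_imp_surj_on[OF f(1)] by auto
    then obtain E where "E \<in> P" "D = f ` E"
      by blast
    then have "compatible P (inclusion P) B C"
      using D f(2) assms(1,2) by (auto simp: compatible_iff)
    with assms(3) show False by simp
  qed
  then show ?thesis
    using im assms(1,2) by blast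
qed

text \<open>If there is no atom, then already \<open>X\<close> fails to be one, which exhibits an
  incompatible pair. Conversely, \<open>incompatible_below\<close> places such a pair below any
  would-be atom.\<close>

lemma atomless_iff:
  "atomless P (inclusion P) \<longleftrightarrow> (\<exists>A\<in>P. \<exists>B\<in>P. \<not> compatible P (inclusion P) A B)"
proof
  assume "atomless P (inclusion P)"
  then show "\<exists>A\<in>P. \<exists>B\<in>P. \<not> compatible P (inclusion P) A B"
    using top unfolding atomless_def At_def by blast
next
  assume "\<exists>A\<in>P. \<exists>B\<in>P. \<not> compatible P (inclusion P) A B"
  then obtain B C where BC: "B \<in> P" "C \<in> P" "\<not> compatible P (inclusion P) B C"
    by blast
  have "A \<notin> At P (inclusion P)" for A
  proof
    assume A: "A \<in> At P (inclusion P)"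
    then have "A \<in> P"
      by (simp add: At_def)
    then obtain B' C' where "B' \<in> P" "C' \<in> P" "B' \<subseteq> A" "C' \<subseteq> A"
        "\<not> compatible P (inclusion P) B' C'"
      using incompatible_below[OF BC] by blast
    with A show False
      by (simp add: At_def inclusion_def relation_of_def)
  qed
  then show "atomless P (inclusion P)"
    by (auto simp: atomless_def)
qed

lemma At_eq_if_not_atomless:
  assumes "\<not> atomless P (inclusion P)"
  shows "At P (inclusion P) = P"
  using assms by (auto simp: atomless_iff At_def)

lemma atomic_iff: "atomic P (inclusion P) \<longleftrightarrow> \<not> atomless P (inclusion P)"
proof
  assume "atomic P (inclusion P)"
  then show "\<not> atomless P (inclusion P)"
    \<comment> \<open>Density applied to \<open>X\<close> provides at least one atom.\<close>
    using top by (auto simp: atomic_def dense_in_def atomless_def)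
next
  assume "\<not> atomless P (inclusion P)"
  then show "atomic P (inclusion P)"
    unfolding atomic_def dense_in_def
    using At_eq_if_not_atomless by (force simp: inclusion_def relation_of_def)
qed

text \<open>With no incompatible pair, pairwise compatibility is exactly the directedness of a
  filter base; the injections onto the members give the cardinality.\<close>

lemma uniform_filter_base_if_not_atomless:
  assumes "\<not> atomless P (inclusion P)"
  shows "uniform_filter_base X P"
proof -
  have "A \<approx> X" if A: "A \<in> P" for A
  proof -
    obtain f where "inj_on f X" "f ` X = A"
      using replicaE[OF A] by metis
    then show ?thesis
      using inj_on_image_eqpoll_self by blast
  qed
  then show ?thesis
    using assms top subset_top unfolding uniform_filter_base_def atomless_iff compatible_iff
    by blast
qed

lemma Inter_mem_iff: "\<Inter>P \<in> P \<longleftrightarrow> P = {X}"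
proof
  assume M: "\<Inter>P \<in> P"
  then obtain f where f: "bij_betw (image f) P {B \<in> P. B \<subseteq> \<Inter>P}"
    using replicaE by metis
  \<comment> \<open>The ideal below a least member is a singleton, and \<open>P\<close> is in
    bijection with it, so \<open>P\<close> has only the element \<open>X\<close>.\<close>
  have "{B \<in> P. B \<subseteq> \<Inter>P} = {\<Inter>P}"
    using M by auto
  with f have "image f ` P = {\<Inter>P}" "inj_on (image f) P"
    by (simp_all add: bij_betw_def)
  then have "A = X" if "A \<in> P" for A
    using top that by (metis imageI inj_onD singletonD)
  then show "P = {X}"
    using top by blast
qed simp

end

section \<open>Self-embeddings of a relational structure and their images\<close>

definition self_embedding ::
    "'i set \<Rightarrow> ('i \<Rightarrow> nat) \<Rightarrow> 'a set \<Rightarrow> ('i \<Rightarrow> 'a list set) \<Rightarrow> ('a \<Rightarrow> 'a) \<Rightarrow> bool" where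
  "self_embedding I ar X \<rho> f \<longleftrightarrow> inj_on f X \<and> f ` X \<subseteq> X \<and>
     (\<forall>i\<in>I. \<forall>xs\<in>nlists (ar i) X. map f xs \<in> \<rho> i \<longleftrightarrow> xs \<in> \<rho> i)"

lemma map_mem_nlists: "xs \<in> nlists n A \<Longrightarrow> f ` A \<subseteq> B \<Longrightarrow> map f xs \<in> nlists n B"
  unfolding nlists_def by simp blast

lemma map_inv_into_cancel:
  assumes "xs \<in> nlists n (f ` A)"
  shows "map f (map (inv_into A f) xs) = xs"
proof -
  have "f (inv_into A f x) = x" if "x \<in> set xs" for x
    using assms that unfolding nlists_def by (blast intro: f_inv_into_f)
  then show ?thesis
    unfolding map_map by (intro map_idI) simp
qed

lemma self_embedding_comp:
  assumes "self_embedding I ar X \<rho> f" "self_embedding I ar X \<rho> g"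
  shows "self_embedding I ar X \<rho> (f \<circ> g)"
proof -
  have "map f (map g xs) \<in> \<rho> i \<longleftrightarrow> xs \<in> \<rho> i" if "i \<in> I" "xs \<in> nlists (ar i) X" for i xs
    using assms that map_mem_nlists[OF that(2), of g X] by (simp add: self_embedding_def del: map_map)
  moreover have "inj_on (f \<circ> g) X"
    using assms by (meson comp_inj_on inj_on_subset self_embedding_def)
  moreover have "(f \<circ> g) ` X \<subseteq> X"
    using assms unfolding self_embedding_def image_comp[symmetric] by blast
  ultimately show ?thesis
    by (simp add: self_embedding_def)
qed

text \<open>When the image of \<open>g\<close> lies in that of \<open>f\<close>, \<open>g\<close>
  factors through \<open>f\<close>; the factor is an embedding because \<open>f\<close> reflects the
  relations that \<open>g\<close> preserves, and conversely.\<close>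

lemma self_embedding_lift:
  assumes f: "self_embedding I ar X \<rho> f" and g: "self_embedding I ar X \<rho> g"
    and sub: "g ` X \<subseteq> f ` X"
  shows "self_embedding I ar X \<rho> (inv_into X f \<circ> g)"
proof -
  let ?h = "inv_into X f \<circ> g"
  have h: "?h ` X \<subseteq> X"
    using sub inv_into_into[of _ f X] by fastforce
  have "map ?h xs \<in> \<rho> i \<longleftrightarrow> xs \<in> \<rho> i" if "i \<in> I" "xs \<in> nlists (ar i) X" for i xs
  proof -
    have "map f (map ?h xs) = map g xs"
      using map_inv_into_cancel[OF map_mem_nlists[OF that(2) sub]] by simp
    then show ?thesis
      using f g that map_mem_nlists[OF that(2) h] unfolding self_embedding_def by metis
  qed
  moreover have "inj_on ?h X"
    using g sub by (auto simp: self_embedding_def intro!: comp_inj_on inj_on_inv_into)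
  ultimately show ?thesis
    using h by (simp add: self_embedding_def)
qed

text \<open>Inverting an isomorphism from a copy onto \<open>X\<close> gives an embedding of
  \<open>X\<close> with that copy as image, and vice versa. Unlike those isomorphisms, embeddings of
  \<open>X\<close> into itself can be composed directly.\<close>

lemma self_copies_iff_self_embedding:
  "A \<in> self_copies I ar X \<rho> \<longleftrightarrow> (\<exists>f. self_embedding I ar X \<rho> f \<and> f ` X = A)"
proof
  assume "A \<in> self_copies I ar X \<rho>"
  then obtain h where A: "A \<subseteq> X" and h: "bij_betw h A X"
      "\<And>i xs. i \<in> I \<Longrightarrow> xs \<in> nlists (ar i) A \<Longrightarrow> xs \<in> \<rho> i \<longleftrightarrow> map h xs \<in> \<rho> i"
    by (auto simp: self_copies_def rel_isomorphic_def rel_isomorphism_def)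
  let ?f = "inv_into A h"
  have f: "bij_betw ?f X A"
    using h(1) by (rule bij_betw_inv_into)
  have "map ?f xs \<in> \<rho> i \<longleftrightarrow> xs \<in> \<rho> i" if "i \<in> I" "xs \<in> nlists (ar i) X" for i xs
  proof -
    \<comment> \<open>The property of \<open>h\<close> is available only for tuples over
      \<open>A\<close>, so it is applied to the pulled-back tuple.\<close>
    have "map ?f xs \<in> nlists (ar i) A"
      using bij_betw_imp_surj_on[OF f] by (intro map_mem_nlists[OF that(2)]) simp
    moreover have "map h (map ?f xs) = xs"
      using that(2) bij_betw_imp_surj_on[OF h(1)] by (intro map_inv_into_cancel) simp
    ultimately show ?thesis
      using h(2)[OF that(1), of "map ?f xs"] by simp
  qed
  then have "self_embedding I ar X \<rho> ?f \<and> ?f ` X = A"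
    using f A by (auto simp: self_embedding_def bij_betw_def)
  then show "\<exists>f. self_embedding I ar X \<rho> f \<and> f ` X = A"
    by blast
next
  assume "\<exists>f. self_embedding I ar X \<rho> f \<and> f ` X = A"
  then obtain f where f: "self_embedding I ar X \<rho> f" "f ` X = A"
    by blast
  let ?h = "inv_into X f"
  have h: "bij_betw ?h A X"
    using f by (intro bij_betw_inv_into) (simp add: self_embedding_def bij_betw_def)
  have "xs \<in> \<rho> i \<longleftrightarrow> map ?h xs \<in> \<rho> i" if "i \<in> I" "xs \<in> nlists (ar i) A" for i xs
  proof -
    have "map ?h xs \<in> nlists (ar i) X"
      using bij_betw_imp_surj_on[OF h] by (intro map_mem_nlists[OF that(2)]) simp
    moreover have "map f (map ?h xs) = xs"
      using that(2) f(2) by (intro map_inv_into_cancel) simp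
    ultimately show ?thesis
      using f(1) that(1) unfolding self_embedding_def by metis
  qed
  \<comment> \<open>Only tuples over \<open>A\<close> are tested, and on these the restricted
    relation agrees with \<open>\<rho> i\<close>.\<close>
  then have "rel_isomorphism I ar A (\<lambda>i. \<rho> i \<inter> nlists (ar i) A) X \<rho> ?h"
    using h by (simp add: rel_isomorphism_def)
  moreover have "A \<subseteq> X"
    using f by (auto simp: self_embedding_def)
  ultimately show "A \<in> self_copies I ar X \<rho>"
    by (auto simp: self_copies_def rel_isomorphic_def)
qed

lemma self_embedding_image_mem_self_copies_iff:
  assumes f: "self_embedding I ar X \<rho> f" and "B \<subseteq> X"
  shows "f ` B \<in> self_copies I ar X \<rho> \<longleftrightarrow> B \<in> self_copies I ar X \<rho>"
proof
  assume "f ` B \<in> self_copies I ar X \<rho>"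
  then obtain g where g: "self_embedding I ar X \<rho> g" "g ` X = f ` B"
    by (auto simp: self_copies_iff_self_embedding)
  have "(inv_into X f \<circ> g) ` X = inv_into X f ` f ` B"
    using g(2) by (metis image_comp)
  also have "\<dots> = B"
    using f assms(2) by (simp add: self_embedding_def inv_into_image_cancel)
  finally show "B \<in> self_copies I ar X \<rho>"
    using self_embedding_lift[OF f g(1)] g(2) assms(2)
    by (metis self_copies_iff_self_embedding image_mono)
next
  assume "B \<in> self_copies I ar X \<rho>"
  then show "f ` B \<in> self_copies I ar X \<rho>"
    using self_embedding_comp[OF f] by (metis self_copies_iff_self_embedding image_comp)
qed

lemma self_similar_family_self_copies: "self_similar_family X (self_copies I ar X \<rho>)"
proof
  have "self_embedding I ar X \<rho> id"
    by (simp add: self_embedding_def)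
  then show "X \<in> self_copies I ar X \<rho>"
    by (metis self_copies_iff_self_embedding image_id id_apply)
next
  fix A assume "A \<in> self_copies I ar X \<rho>"
  then obtain f where f: "self_embedding I ar X \<rho> f" "f ` X = A"
    by (auto simp: self_copies_iff_self_embedding)
  then have "inj_on f X" "A \<subseteq> X"
    by (auto simp: self_embedding_def)
  then show "\<exists>f. inj_on f X \<and> f ` X = A \<and> A \<subseteq> X \<and>
      (\<forall>B\<subseteq>X. f ` B \<in> self_copies I ar X \<rho> \<longleftrightarrow> B \<in> self_copies I ar X \<rho>)"
    using f self_embedding_image_mem_self_copies_iff[OF f(1)] by blast
qed

theorem theorem2p2:
  fixes I :: "'i set" and ar :: "'i \<Rightarrow> nat"
    and X :: "'a set" and \<rho> :: "'i \<Rightarrow> 'a list set"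
  assumes "relational_structure I ar X \<rho>"
  shows
    "homogeneous_poset (self_copies I ar X \<rho>) (inclusion (self_copies I ar X \<rho>)) \<and>
     (atomless (self_copies I ar X \<rho>) (inclusion (self_copies I ar X \<rho>)) \<or>
      atomic (self_copies I ar X \<rho>) (inclusion (self_copies I ar X \<rho>))) \<and>
     (atomless (self_copies I ar X \<rho>) (inclusion (self_copies I ar X \<rho>)) \<longleftrightarrow>
      (\<exists>A\<in>self_copies I ar X \<rho>. \<exists>B\<in>self_copies I ar X \<rho>.
         \<not> compatible (self_copies I ar X \<rho>) (inclusion (self_copies I ar X \<rho>)) A B)) \<and>
     (atomic (self_copies I ar X \<rho>) (inclusion (self_copies I ar X \<rho>)) \<longrightarrow>
        At (self_copies I ar X \<rho>) (inclusion (self_copies I ar X \<rho>)) = self_copies I ar X \<rho> \<and>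
        uniform_filter_base X (self_copies I ar X \<rho>)) \<and>
     (\<Inter>(self_copies I ar X \<rho>) \<in> self_copies I ar X \<rho> \<longleftrightarrow> self_copies I ar X \<rho> = {X})"
proof -
  interpret self_similar_family X "self_copies I ar X \<rho>"
    by (rule self_similar_family_self_copies)
  show ?thesis
    \<comment> \<open>Rewriting atomic as not atomless turns the dichotomy into a tautology.\<close>
    using homogeneous Inter_mem_iff
    by (simp add: atomic_iff At_eq_if_not_atomless uniform_filter_base_if_not_atomless
        flip: atomless_iff)
qed

end
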